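(* Let $d \geq 1$ and let $\sigma$ be an automorphism of $\mathbb{Z}^{2d}$ whose matrix with respect to the standard basis of $\mathbb{Z}^{2d}$ is block upper triangular with $2\times 2$ blocks, each diagonal block being one of the matrices $$\begin{pmatrix}0 & 1 \\1 & 0\end{pmatrix},\qquad \begin{pmatrix}0 & -1 \\-1 & 0\end{pmatrix}.$$ Then there exists a subset $A$ of $\mathbb{Z}^{2d}$ contained in a quadrant such that $(A, \sigma(A))$ is a co-minimal pair in $\mathbb{Z}^{2d}$.
   Context: For nonempty subsets $A, B$ of an abelian group $(G,+)$, write $A + B = \{a+b \mid a\in A, b\in B\}$. The pair $(A,B)$ is called a co-minimal pair in $G$ if $A + B = G$, $A' + B \subsetneq G$ for every $\emptyset \neq A' \subsetneq A$, and $A + B' \subsetneq G$ for every $\emptyset \neq B' \subsetneq B$. A subset $X$ of $\mathbb{Z}^m$ is said to be contained in a quadrant if for each $1 \leq i \leq m$, either the $i$-th coordinate of every point of $X$ is positive, or the $i$-th coordinate of every point of $X$ is negative. Matrices act on column vectors, so block upper triangularity means that for each $1\le k\le d$ the subgroup generated by the first $2k$ standard basis vectors is $\sigma$-stable. *)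

theory Defs
  imports "Jordan_Normal_Form.Matrix" "HOL-Algebra.Coset"
begin

text \<open>The group is written multiplicatively, as in HOL-Algebra; \<open>A <#>\<^bsub>G\<^esub> B\<close> is the sumset
  of \<open>A\<close> and \<open>B\<close>. The notion is meant for an abelian group \<open>G\<close>.\<close>

definition co_minimal_pair :: "('a, 'b) monoid_scheme \<Rightarrow> 'a set \<Rightarrow> 'a set \<Rightarrow> bool" where
  "co_minimal_pair G A B \<longleftrightarrow>
     A \<subseteq> carrier G \<and> B \<subseteq> carrier G \<and> A \<noteq> {} \<and> B \<noteq> {} \<and>
     A <#>\<^bsub>G\<^esub> B = carrier G \<and>
     (\<forall>A'. A' \<noteq> {} \<and> A' \<subset> A \<longrightarrow> A' <#>\<^bsub>G\<^esub> B \<subset> carrier G) \<and>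
     (\<forall>B'. B' \<noteq> {} \<and> B' \<subset> B \<longrightarrow> A <#>\<^bsub>G\<^esub> B' \<subset> carrier G)"

abbreviation int_lattice :: "nat \<Rightarrow> int vec monoid" where
  "int_lattice m \<equiv> monoid_vec TYPE(int) m"

definition contained_in_quadrant :: "nat \<Rightarrow> int vec set \<Rightarrow> bool" where
  "contained_in_quadrant m X \<longleftrightarrow>
     X \<subseteq> carrier_vec m \<and>
     (\<forall>i<m. (\<forall>x\<in>X. x $ i > 0) \<or> (\<forall>x\<in>X. x $ i < 0))"

text \<open>Matrices act on column vectors: column \<open>j\<close> is the image of the \<open>j\<close>-th standard basis vector.\<close>

definition matrix_of_map :: "nat \<Rightarrow> (int vec \<Rightarrow> int vec) \<Rightarrow> int mat" where
  "matrix_of_map m \<sigma> = mat m m (\<lambda>(i, j). \<sigma> (unit_vec m j) $ i)"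

text \<open>Indices start at \<open>0\<close>, so the \<open>(k, l)\<close> block occupies rows \<open>2k, 2k+1\<close> and columns \<open>2l, 2l+1\<close>.\<close>

definition block2 :: "int mat \<Rightarrow> nat \<Rightarrow> nat \<Rightarrow> int mat" where
  "block2 M k l = mat 2 2 (\<lambda>(i, j). M $$ (2 * k + i, 2 * l + j))"

definition block2_upper_triangular :: "nat \<Rightarrow> int mat \<Rightarrow> bool" where
  "block2_upper_triangular d M \<longleftrightarrow>
     M \<in> carrier_mat (2 * d) (2 * d) \<and>
     (\<forall>k<d. \<forall>l<k. block2 M k l = 0\<^sub>m 2 2)"

end

theory Submission
  imports Defs "HOL-Library.Countable_Set"
begin

text \<open>
  The set is built greedily. Write \<open>s x y = x + \<sigma> y\<close>. A finite set \<open>A\<close> in the chosen quadrant is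
  called irredundant if every element \<open>a\<close> has a witness forcing it to the left, a value \<open>s a z\<close>
  all of whose representations \<open>s x y\<close> over \<open>A\<close> have \<open>x = a\<close>, and likewise a witness forcing it
  to the right. An irredundant \<open>A\<close> whose values \<open>s x y\<close> exhaust the lattice gives the co-minimal
  pair \<open>(A, \<sigma>(A))\<close>. Given a lattice point \<open>g\<close> that is not yet a value, one adjoins two points
  \<open>a\<close>, \<open>b\<close> with \<open>s a b = g\<close>; here \<open>b\<close> is far out in the quadrant and \<open>a = g - \<sigma> b\<close>. If no new sum
  equals an old value, old witnesses survive, so the union of the stages over an enumeration of
  the lattice is again irredundant.

  Three points need an argument.

  \<^item> Both \<open>a\<close> and \<open>b\<close> must lie in the quadrant. If the diagonal block number \<open>k\<close> has sign
    \<open>\<epsilon>\<^sub>k\<close>, the quadrant prescribes the signs \<open>(+, -\<epsilon>\<^sub>k)\<close> in the coordinates of that block, and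
    then \<open>-\<sigma>\<close> preserves the signs as far as the diagonal blocks are concerned. The blocks above
    the diagonal do no harm if \<open>b\<close> is \<open>(\<plusminus>T\<^sup>m, \<plusminus>T\<^sup>m\<^sup>-\<^sup>1, \<dots>, \<plusminus>T)\<close> with \<open>m = 2d\<close> and \<open>T\<close>
    large: the sign of an additive functional at \<open>b\<close> is then decided by the first basis vector
    on which it does not vanish (\<open>functional_eventually_large\<close>).

  \<^item> The sums involving \<open>a\<close> or \<open>b\<close>, other than \<open>s a b\<close> and \<open>s b a\<close>, must differ from each other
    and from the old values to the extent that the new witnesses need. It suffices to look at
    one coordinate, the first one of the last block (\<open>irredundant_adjoin_pair\<close>): on the last
    block \<open>\<sigma>\<close> acts as \<open>\<plusminus>\<close> the swap, so all these sums are visible there as small integer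
    combinations of two numbers of very different size.

  \<^item> The reversed sum \<open>s b a = \<sigma> g + (b - \<sigma>\<^sup>2 b)\<close> must not be an old value; in that coordinate
    it looks like one. If \<open>\<sigma>\<^sup>2\<close> is not the identity, \<open>b - \<sigma>\<^sup>2 b\<close> leaves every finite set as
    \<open>T\<close> grows. If \<open>\<sigma>\<^sup>2\<close> is the identity, the sum is \<open>\<sigma> g\<close>, and the old values are \<open>\<sigma>\<close>-stable,
    so \<open>\<sigma> g\<close> is new because \<open>g\<close> is (\<open>reversed_sum_eventually_new\<close>).
\<close>

section \<open>Irredundant sets for a binary operation\<close>

definition pair_values :: "('a \<Rightarrow> 'a \<Rightarrow> 'b) \<Rightarrow> 'a set \<Rightarrow> 'b set" where
  "pair_values s A = {s x y | x y. x \<in> A \<and> y \<in> A}"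

text \<open>The two conjuncts forbid dropping \<open>a\<close> as a left and as a right argument of \<open>s\<close>, respectively:
  the value \<open>s a z\<close>, respectively \<open>s z a\<close>, would be lost.\<close>

definition irredundant :: "('a \<Rightarrow> 'a \<Rightarrow> 'b) \<Rightarrow> 'a set \<Rightarrow> bool" where
  "irredundant s A \<longleftrightarrow>
     (\<forall>a\<in>A. (\<exists>z\<in>A. \<forall>x\<in>A. \<forall>y\<in>A. s x y = s a z \<longrightarrow> x = a) \<and>
            (\<exists>z\<in>A. \<forall>x\<in>A. \<forall>y\<in>A. s x y = s z a \<longrightarrow> y = a))"

text \<open>Witnesses survive this kind of extension: a witness is an old value, and only a new
  representation could spoil it.\<close>

definition pure_extension :: "('a \<Rightarrow> 'a \<Rightarrow> 'b) \<Rightarrow> 'a set \<Rightarrow> 'a set \<Rightarrow> bool" where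
  "pure_extension s A A' \<longleftrightarrow>
     A \<subseteq> A' \<and> (\<forall>x\<in>A'. \<forall>y\<in>A'. s x y \<in> pair_values s A \<longrightarrow> x \<in> A \<and> y \<in> A)"

lemma pair_valuesI: "x \<in> A \<Longrightarrow> y \<in> A \<Longrightarrow> s x y \<in> pair_values s A"
  by (auto simp: pair_values_def)

lemma pair_valuesE:
  assumes "h \<in> pair_values s A"
  obtains x y where "x \<in> A" "y \<in> A" "h = s x y"
  using assms by (auto simp: pair_values_def)

lemma pair_values_mono: "A \<subseteq> B \<Longrightarrow> pair_values s A \<subseteq> pair_values s B"
  by (auto simp: pair_values_def)

lemma pure_extension_refl: "pure_extension s A A"
  by (simp add: pure_extension_def)

lemma pure_extension_trans:
  assumes "pure_extension s A B" "pure_extension s B C"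
  shows "pure_extension s A C"
  using assms pair_values_mono[of A B s] unfolding pure_extension_def by blast

lemma pure_extension_keeps_witnesses:
  assumes irr: "irredundant s A" and pure: "pure_extension s A A'" and a: "a \<in> A"
  shows "\<exists>z\<in>A'. \<forall>x\<in>A'. \<forall>y\<in>A'. s x y = s a z \<longrightarrow> x = a"
    and "\<exists>z\<in>A'. \<forall>x\<in>A'. \<forall>y\<in>A'. s x y = s z a \<longrightarrow> y = a"
proof -
  have sub: "A \<subseteq> A'"
    and old: "\<And>x y. x \<in> A' \<Longrightarrow> y \<in> A' \<Longrightarrow> s x y \<in> pair_values s A \<Longrightarrow> x \<in> A \<and> y \<in> A"
    using pure by (auto simp: pure_extension_def)
  obtain z where z: "z \<in> A" "\<forall>x\<in>A. \<forall>y\<in>A. s x y = s a z \<longrightarrow> x = a"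
    using irr a unfolding irredundant_def by blast
  obtain w where w: "w \<in> A" "\<forall>x\<in>A. \<forall>y\<in>A. s x y = s w a \<longrightarrow> y = a"
    using irr a unfolding irredundant_def by blast
  show "\<exists>z\<in>A'. \<forall>x\<in>A'. \<forall>y\<in>A'. s x y = s a z \<longrightarrow> x = a"
  proof (intro bexI[of _ z] ballI impI)
    fix x y assume xy: "x \<in> A'" "y \<in> A'" "s x y = s a z"
    then have "s x y \<in> pair_values s A" using a z(1) by (simp add: pair_valuesI)
    with old xy z show "x = a" by blast
  qed (use sub z(1) in auto)
  show "\<exists>z\<in>A'. \<forall>x\<in>A'. \<forall>y\<in>A'. s x y = s z a \<longrightarrow> y = a"
  proof (intro bexI[of _ w] ballI impI)
    fix x y assume xy: "x \<in> A'" "y \<in> A'" "s x y = s w a"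
    then have "s x y \<in> pair_values s A" using a w(1) by (simp add: pair_valuesI)
    with old xy w show "y = a" by blast
  qed (use sub w(1) in auto)
qed

text \<open>Pure extensions compose, so every stage of the chain is purely extended by the union of all
  stages. A witness chosen at a finite stage therefore still serves in the union.\<close>

lemma irredundant_cover_by_exhaustion:
  fixes s :: "'a \<Rightarrow> 'a \<Rightarrow> 'b"
  assumes C: "countable C"
    and start: "A0 \<subseteq> Q" "finite A0" "A0 \<noteq> {}" "irredundant s A0"
    and step: "\<And>A g. A \<subseteq> Q \<Longrightarrow> finite A \<Longrightarrow> A \<noteq> {} \<Longrightarrow> irredundant s A \<Longrightarrow> g \<in> C \<Longrightarrow>
      \<exists>A'. A' \<subseteq> Q \<and> finite A' \<and> irredundant s A' \<and> pure_extension s A A' \<and> g \<in> pair_values s A'"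
  shows "\<exists>A. A \<subseteq> Q \<and> A \<noteq> {} \<and> irredundant s A \<and> C \<subseteq> pair_values s A"
proof (cases "C = {}")
  case True
  then show ?thesis using start by blast
next
  case False
  define e :: "nat \<Rightarrow> 'b" where "e = from_nat_into C"
  have e: "range e = C" using False C by (simp add: e_def)
  have "\<exists>f. \<forall>n. (f n \<subseteq> Q \<and> finite (f n) \<and> f n \<noteq> {} \<and> irredundant s (f n)) \<and>
               (pure_extension s (f n) (f (Suc n)) \<and> e n \<in> pair_values s (f (Suc n)))"
  proof (rule dependent_nat_choice)
    show "\<exists>A. A \<subseteq> Q \<and> finite A \<and> A \<noteq> {} \<and> irredundant s A" using start by blast
    fix A n assume "A \<subseteq> Q \<and> finite A \<and> A \<noteq> {} \<and> irredundant s A"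
    moreover have "e n \<in> C" using e by blast
    ultimately obtain A' where "A' \<subseteq> Q" "finite A'" "irredundant s A'" "pure_extension s A A'"
      "e n \<in> pair_values s A'" "A \<noteq> {}" using step by meson
    then show "\<exists>A'. (A' \<subseteq> Q \<and> finite A' \<and> A' \<noteq> {} \<and> irredundant s A') \<and>
        (pure_extension s A A' \<and> e n \<in> pair_values s A')"
      by (intro exI[of _ A']) (auto simp: pure_extension_def)
  qed
  then obtain f where f: "\<And>n. f n \<subseteq> Q" "\<And>n. f n \<noteq> {}" "\<And>n. irredundant s (f n)"
    and pure: "\<And>n. pure_extension s (f n) (f (Suc n))"
    and val: "\<And>n. e n \<in> pair_values s (f (Suc n))" by blast
  have pure_le: "pure_extension s (f n) (f k)" if "n \<le> k" for n k
    using that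
  proof (induction k rule: dec_induct)
    case base show ?case by (rule pure_extension_refl)
  next
    case (step k) then show ?case using pure pure_extension_trans by blast
  qed
  define A where "A = (\<Union>n. f n)"
  have pureA: "pure_extension s (f n) A" for n
    unfolding pure_extension_def
  proof (intro conjI ballI impI)
    show "f n \<subseteq> A" by (auto simp: A_def)
    fix x y assume "x \<in> A" "y \<in> A" and v: "s x y \<in> pair_values s (f n)"
    then obtain i j where ij: "x \<in> f i" "y \<in> f j" by (auto simp: A_def)
    define k where "k = max n (max i j)"
    have "x \<in> f k" "y \<in> f k"
      using pure_le[of i k] pure_le[of j k] ij unfolding pure_extension_def k_def
      by (meson max.cobounded1 max.cobounded2 max.coboundedI2 subsetD)+
    moreover have "pure_extension s (f n) (f k)" using pure_le by (simp add: k_def)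
    ultimately show "x \<in> f n" "y \<in> f n" using v by (auto simp: pure_extension_def)
  qed
  have "irredundant s A"
    unfolding irredundant_def
  proof (intro ballI conjI)
    fix a assume "a \<in> A"
    then obtain n where n: "a \<in> f n" by (auto simp: A_def)
    show "\<exists>z\<in>A. \<forall>x\<in>A. \<forall>y\<in>A. s x y = s a z \<longrightarrow> x = a"
      "\<exists>z\<in>A. \<forall>x\<in>A. \<forall>y\<in>A. s x y = s z a \<longrightarrow> y = a"
      using pure_extension_keeps_witnesses[OF f(3) pureA n] by blast+
  qed
  moreover have "C \<subseteq> pair_values s A"
  proof
    fix g assume "g \<in> C"
    then obtain n where "g = e n" using e by blast
    then have "g \<in> pair_values s (f (Suc n))" using val by simp
    then show "g \<in> pair_values s A"
      using pair_values_mono[of "f (Suc n)" A s] by (auto simp: A_def)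
  qed
  moreover have "A \<subseteq> Q" "A \<noteq> {}" using f by (auto simp: A_def)
  ultimately show ?thesis by blast
qed

text \<open>Removing \<open>a\<close> from the first set loses the left witness of \<open>a\<close>. Removing \<open>\<sigma> a\<close> from the second
  set loses the right witness of \<open>a\<close>, whose representations over \<open>A\<close> all use \<open>a\<close> itself.\<close>

lemma co_minimal_pair_if_irredundant_cover:
  assumes A: "A \<subseteq> carrier G" "A \<noteq> {}"
    and \<sigma>: "\<sigma> \<in> carrier G \<rightarrow> carrier G" and G: "monoid G"
    and irr: "irredundant (\<lambda>x y. x \<otimes>\<^bsub>G\<^esub> \<sigma> y) A"
    and cover: "carrier G \<subseteq> pair_values (\<lambda>x y. x \<otimes>\<^bsub>G\<^esub> \<sigma> y) A"
  shows "co_minimal_pair G A (\<sigma> ` A)"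
proof -
  interpret monoid G by (rule G)
  have \<sigma>A: "\<sigma> ` A \<subseteq> carrier G" using A(1) \<sigma> by auto
  have closed: "X <#>\<^bsub>G\<^esub> Y \<subseteq> carrier G" if "X \<subseteq> A" "Y \<subseteq> \<sigma> ` A" for X Y
    using that A(1) \<sigma>A unfolding set_mult_def by blast
  have full: "A <#>\<^bsub>G\<^esub> \<sigma> ` A = carrier G"
  proof
    show "carrier G \<subseteq> A <#>\<^bsub>G\<^esub> \<sigma> ` A"
      using cover unfolding set_mult_def pair_values_def by blast
  qed (rule closed[OF order_refl order_refl])
  have left: "A' <#>\<^bsub>G\<^esub> \<sigma> ` A \<subset> carrier G" if sub: "A' \<subset> A" for A'
  proof -
    obtain a where a: "a \<in> A" "a \<notin> A'" using sub by blast
    then obtain z where z: "z \<in> A" "\<forall>x\<in>A. \<forall>y\<in>A. x \<otimes>\<^bsub>G\<^esub> \<sigma> y = a \<otimes>\<^bsub>G\<^esub> \<sigma> z \<longrightarrow> x = a"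
      using irr unfolding irredundant_def by blast
    have "a \<otimes>\<^bsub>G\<^esub> \<sigma> z \<in> carrier G" using A(1) \<sigma> a z(1) by auto
    moreover have "a \<otimes>\<^bsub>G\<^esub> \<sigma> z \<notin> A' <#>\<^bsub>G\<^esub> \<sigma> ` A"
    proof
      assume "a \<otimes>\<^bsub>G\<^esub> \<sigma> z \<in> A' <#>\<^bsub>G\<^esub> \<sigma> ` A"
      then obtain x y where "x \<in> A'" "y \<in> A" "x \<otimes>\<^bsub>G\<^esub> \<sigma> y = a \<otimes>\<^bsub>G\<^esub> \<sigma> z"
        by (auto simp: set_mult_def)
      with z sub a show False by blast
    qed
    ultimately show ?thesis using closed[of A' "\<sigma> ` A"] sub by blast
  qed
  have right: "A <#>\<^bsub>G\<^esub> B' \<subset> carrier G" if sub: "B' \<subset> \<sigma> ` A" for B'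
  proof -
    obtain a where a: "a \<in> A" "\<sigma> a \<notin> B'" using sub by blast
    then obtain z where z: "z \<in> A" "\<forall>x\<in>A. \<forall>y\<in>A. x \<otimes>\<^bsub>G\<^esub> \<sigma> y = z \<otimes>\<^bsub>G\<^esub> \<sigma> a \<longrightarrow> y = a"
      using irr unfolding irredundant_def by blast
    have "z \<otimes>\<^bsub>G\<^esub> \<sigma> a \<in> carrier G" using A(1) \<sigma> a z(1) by auto
    moreover have "z \<otimes>\<^bsub>G\<^esub> \<sigma> a \<notin> A <#>\<^bsub>G\<^esub> B'"
    proof
      assume "z \<otimes>\<^bsub>G\<^esub> \<sigma> a \<in> A <#>\<^bsub>G\<^esub> B'"
      then obtain x w where w: "x \<in> A" "w \<in> B'" "x \<otimes>\<^bsub>G\<^esub> w = z \<otimes>\<^bsub>G\<^esub> \<sigma> a"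
        by (auto simp: set_mult_def)
      then obtain y where y: "y \<in> A" "w = \<sigma> y" using sub by blast
      have "y = a" using z(2) w y by blast
      then show False using w y a by simp
    qed
    ultimately show ?thesis using closed[of A B'] sub by blast
  qed
  show ?thesis
    unfolding co_minimal_pair_def using A \<sigma>A full left right by auto
qed

text \<open>Put \<open>X = \<phi> b\<close> and \<open>Y = \<psi> b\<close>. By \<open>cross\<close>, \<open>\<phi> a\<close> is close to \<open>-Y\<close> and \<open>\<psi> a\<close> is close to
  \<open>-X\<close>. For \<open>x\<close> in \<open>A\<close>, the functional \<open>F\<close> thus takes the following values up to an error of \<open>2M\<close>:
  \<open>-Y\<close> at \<open>s a x\<close>, \<open>-X\<close> at \<open>s x a\<close>, \<open>Y\<close> at \<open>s x b\<close>, \<open>X\<close> at \<open>s b x\<close>, \<open>-X-Y\<close> at \<open>s a a\<close>, \<open>X+Y\<close> at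
  \<open>s b b\<close>, and \<open>0\<close> at \<open>s a b\<close>, at \<open>s b a\<close> and at the old values. The assumption \<open>big\<close> makes these
  seven numbers differ pairwise by more than \<open>4M\<close>, so sums of different kinds are different.
  The two sums for which \<open>F\<close> cannot exclude an old value are covered by \<open>new\<close>. Any fixed \<open>c\<close> in
  \<open>A\<close> then supplies the four new witnesses \<open>s a c\<close>, \<open>s c a\<close>, \<open>s b c\<close>, \<open>s c b\<close>: two sums of the same
  kind share their new argument.\<close>

lemma irredundant_adjoin_pair:
  fixes s :: "'a \<Rightarrow> 'a \<Rightarrow> 'b" and F :: "'b \<Rightarrow> int" and \<phi> \<psi> :: "'a \<Rightarrow> int" and M :: int
  assumes F: "\<And>x y. x \<in> insert a (insert b A) \<Longrightarrow> y \<in> insert a (insert b A) \<Longrightarrow> F (s x y) = \<phi> x + \<psi> y"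
    and ne: "A \<noteq> {}" and irr: "irredundant s A"
    and bound: "\<And>x. x \<in> A \<Longrightarrow> \<bar>\<phi> x\<bar> \<le> M \<and> \<bar>\<psi> x\<bar> \<le> M"
    and cross: "\<bar>\<phi> a + \<psi> b\<bar> \<le> M" "\<bar>\<phi> b + \<psi> a\<bar> \<le> M"
    and new: "s a b \<notin> pair_values s A" "s b a \<notin> pair_values s A"
    and big: "5 * M < - \<psi> b" "5 * M < \<phi> b + 3 * \<psi> b"
  shows "pure_extension s A (insert a (insert b A))"
    and "irredundant s (insert a (insert b A))"
proof -
  let ?A = "insert a (insert b A)"
  have le: "- M \<le> \<phi> x" "\<phi> x \<le> M" "- M \<le> \<psi> x" "\<psi> x \<le> M" if "x \<in> A" for x
    using bound[OF that] by auto
  have cross': "\<phi> a + \<psi> b \<le> M" "- M \<le> \<phi> a + \<psi> b" "\<phi> b + \<psi> a \<le> M" "- M \<le> \<phi> b + \<psi> a"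
    using cross by auto
  have eqF: "\<phi> x + \<psi> y = \<phi> u + \<psi> v"
    if "x \<in> ?A" "y \<in> ?A" "u \<in> ?A" "v \<in> ?A" "s x y = s u v" for x y u v
    using F[OF that(1,2)] F[OF that(3,4)] that(5) by simp
  show pure: "pure_extension s A ?A"
    unfolding pure_extension_def
  proof (intro conjI ballI impI)
    fix x y assume x: "x \<in> ?A" and y: "y \<in> ?A" and v: "s x y \<in> pair_values s A"
    obtain u w where uw: "u \<in> A" "w \<in> A" "s x y = s u w" using v by (rule pair_valuesE)
    have eq: "\<phi> x + \<psi> y = \<phi> u + \<psi> w" using eqF[of x y u w] x y uw by blast
    note bu = le[OF uw(1)] le[OF uw(2)]
    have "x \<in> A \<and> y \<in> A"
    proof (rule ccontr)
      assume "\<not> (x \<in> A \<and> y \<in> A)"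
      then consider "x = a" "y = a" | "x = a" "y = b" | "x = b" "y = a" | "x = b" "y = b"
        | "x = a" "y \<in> A" | "x = b" "y \<in> A" | "x \<in> A" "y = a" | "x \<in> A" "y = b"
        using x y by blast
      then show False
      proof cases
        case 1 then show False using eq[unfolded 1] bu cross' big by linarith
      next
        case 2 then show False using v new by simp
      next
        case 3 then show False using v new by simp
      next
        case 4 then show False using eq[unfolded 4] bu cross' big by linarith
      next
        case 5 then show False using eq[unfolded 5(1)] bu le[OF 5(2)] cross' big by linarith
      next
        case 6 then show False using eq[unfolded 6(1)] bu le[OF 6(2)] cross' big by linarith
      next
        case 7 then show False using eq[unfolded 7(2)] bu le[OF 7(1)] cross' big by linarith
      next
        case 8 then show False using eq[unfolded 8(2)] bu le[OF 8(1)] cross' big by linarith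
      qed
    qed
    then show "x \<in> A" "y \<in> A" by auto
  qed auto
  obtain c where c: "c \<in> A" using ne by blast
  note bc = le[OF c]
  have num_a: "\<phi> x = \<phi> b \<and> \<psi> x = \<psi> b \<or> - M \<le> \<phi> x \<and> \<phi> x \<le> M \<and> - M \<le> \<psi> x \<and> \<psi> x \<le> M" if "x \<in> ?A" "x \<noteq> a" for x
    using that le by auto
  have num_b: "\<phi> x = \<phi> a \<and> \<psi> x = \<psi> a \<or> - M \<le> \<phi> x \<and> \<phi> x \<le> M \<and> - M \<le> \<psi> x \<and> \<psi> x \<le> M" if "x \<in> ?A" "x \<noteq> b" for x
    using that le by auto
  have num: "\<phi> x = \<phi> a \<and> \<psi> x = \<psi> a \<or> \<phi> x = \<phi> b \<and> \<psi> x = \<psi> b \<or> - M \<le> \<phi> x \<and> \<phi> x \<le> M \<and> - M \<le> \<psi> x \<and> \<psi> x \<le> M" if "x \<in> ?A" for x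
    using num_a[OF that] by blast
  have left_a: "x = a" if xy: "x \<in> ?A" "y \<in> ?A" and e: "s x y = s a c" for x y
  proof (rule ccontr)
    assume "x \<noteq> a"
    have eq: "\<phi> x + \<psi> y = \<phi> a + \<psi> c" using eqF[of x y a c] xy c e by blast
    show False
      using num_a[OF xy(1) \<open>x \<noteq> a\<close>] num[OF xy(2)] eq bc cross' big
      by - (elim disjE conjE; linarith)
  qed
  have left_b: "x = b" if xy: "x \<in> ?A" "y \<in> ?A" and e: "s x y = s b c" for x y
  proof (rule ccontr)
    assume "x \<noteq> b"
    have eq: "\<phi> x + \<psi> y = \<phi> b + \<psi> c" using eqF[of x y b c] xy c e by blast
    show False
      using num_b[OF xy(1) \<open>x \<noteq> b\<close>] num[OF xy(2)] eq bc cross' big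
      by - (elim disjE conjE; linarith)
  qed
  have right_a: "y = a" if xy: "x \<in> ?A" "y \<in> ?A" and e: "s x y = s c a" for x y
  proof (rule ccontr)
    assume "y \<noteq> a"
    have eq: "\<phi> x + \<psi> y = \<phi> c + \<psi> a" using eqF[of x y c a] xy c e by blast
    show False
      using num_a[OF xy(2) \<open>y \<noteq> a\<close>] num[OF xy(1)] eq bc cross' big
      by - (elim disjE conjE; linarith)
  qed
  have right_b: "y = b" if xy: "x \<in> ?A" "y \<in> ?A" and e: "s x y = s c b" for x y
  proof (rule ccontr)
    assume "y \<noteq> b"
    have eq: "\<phi> x + \<psi> y = \<phi> c + \<psi> b" using eqF[of x y c b] xy c e by blast
    show False
      using num_b[OF xy(2) \<open>y \<noteq> b\<close>] num[OF xy(1)] eq bc cross' big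
      by - (elim disjE conjE; linarith)
  qed
  show "irredundant s ?A"
    unfolding irredundant_def
  proof (intro ballI)
    fix p assume "p \<in> ?A"
    then consider "p = a" | "p = b" | "p \<in> A" by blast
    then show "(\<exists>z\<in>?A. \<forall>x\<in>?A. \<forall>y\<in>?A. s x y = s p z \<longrightarrow> x = p) \<and>
               (\<exists>z\<in>?A. \<forall>x\<in>?A. \<forall>y\<in>?A. s x y = s z p \<longrightarrow> y = p)"
    proof cases
      case 1
      have "c \<in> ?A" using c by simp
      moreover have "\<forall>x\<in>?A. \<forall>y\<in>?A. s x y = s a c \<longrightarrow> x = a"
        "\<forall>x\<in>?A. \<forall>y\<in>?A. s x y = s c a \<longrightarrow> y = a"
        by (intro ballI impI, rule left_a; assumption)
          (intro ballI impI, rule right_a; assumption)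
      ultimately show ?thesis unfolding 1 by (intro conjI bexI[of _ c])
    next
      case 2
      have "c \<in> ?A" using c by simp
      moreover have "\<forall>x\<in>?A. \<forall>y\<in>?A. s x y = s b c \<longrightarrow> x = b"
        "\<forall>x\<in>?A. \<forall>y\<in>?A. s x y = s c b \<longrightarrow> y = b"
        by (intro ballI impI, rule left_b; assumption)
          (intro ballI impI, rule right_b; assumption)
      ultimately show ?thesis unfolding 2 by (intro conjI bexI[of _ c])
    next
      case 3
      show ?thesis using pure_extension_keeps_witnesses[OF irr pure 3] by blast
    qed
  qed
qed

section \<open>Additive functionals at rapidly decreasing vectors\<close>

definition additive_functional :: "nat \<Rightarrow> (int vec \<Rightarrow> int) \<Rightarrow> bool" where
  "additive_functional m \<theta> \<longleftrightarrow>
     (\<forall>v\<in>carrier_vec m. \<forall>w\<in>carrier_vec m. \<theta> (v + w) = \<theta> v + \<theta> w)"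

lemma additive_functionalD:
  "additive_functional m \<theta> \<Longrightarrow> v \<in> carrier_vec m \<Longrightarrow> w \<in> carrier_vec m \<Longrightarrow>
     \<theta> (v + w) = \<theta> v + \<theta> w"
  by (simp add: additive_functional_def)

lemma additive_functional_zero:
  assumes "additive_functional m \<theta>" shows "\<theta> (0\<^sub>v m) = 0"
  using additive_functionalD[OF assms, of "0\<^sub>v m" "0\<^sub>v m"] by simp

lemma additive_functional_smult:
  assumes add: "additive_functional m \<theta>" and v: "v \<in> carrier_vec m"
  shows "\<theta> (c \<cdot>\<^sub>v v) = c * \<theta> v"
proof (induction c rule: int_induct[where k = 0])
  case base
  have "0 \<cdot>\<^sub>v v = 0\<^sub>v m" using v by auto
  then show ?case using additive_functional_zero[OF add] by simp
next
  case (step1 i)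
  have "(i + 1) \<cdot>\<^sub>v v = i \<cdot>\<^sub>v v + v" using v by (auto simp: algebra_simps)
  then show ?case
    using additive_functionalD[OF add, of "i \<cdot>\<^sub>v v" v] v step1 by (simp add: algebra_simps)
next
  case (step2 i)
  have "i \<cdot>\<^sub>v v = (i - 1) \<cdot>\<^sub>v v + v" using v by (auto simp: algebra_simps)
  then show ?case
    using additive_functionalD[OF add, of "(i - 1) \<cdot>\<^sub>v v" v] v step2 by (simp add: algebra_simps)
qed

lemma additive_functional_expand:
  assumes add: "additive_functional m \<theta>" and v: "v \<in> carrier_vec m"
  shows "\<theta> v = (\<Sum>j<m. v $ j * \<theta> (unit_vec m j))"
proof -
  have "\<theta> (vec m (\<lambda>j. if j < k then v $ j else 0)) = (\<Sum>j<k. v $ j * \<theta> (unit_vec m j))"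
    if "k \<le> m" for k
    using that
  proof (induction k)
    case 0
    have "vec m (\<lambda>j. if j < (0::nat) then v $ j else 0) = 0\<^sub>v m" by auto
    then show ?case using additive_functional_zero[OF add] by simp
  next
    case (Suc k)
    have "vec m (\<lambda>j. if j < Suc k then v $ j else 0)
        = vec m (\<lambda>j. if j < k then v $ j else 0) + v $ k \<cdot>\<^sub>v unit_vec m k"
      using Suc.prems by (intro eq_vecI) (auto simp: less_Suc_eq)
    then show ?case
      using Suc additive_functionalD[OF add, of "vec m (\<lambda>j. if j < k then v $ j else 0)" "v $ k \<cdot>\<^sub>v unit_vec m k"]
        additive_functional_smult[OF add, of "unit_vec m k" "v $ k"] by simp
  qed
  from this[of m] have "\<theta> (vec m (\<lambda>j. if j < m then v $ j else 0)) = (\<Sum>j<m. v $ j * \<theta> (unit_vec m j))"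
    by simp
  moreover have "vec m (\<lambda>j. if j < m then v $ j else 0) = v" using v by auto
  ultimately show ?thesis by simp
qed

text \<open>Once \<open>T\<close> exceeds the sum \<open>C\<close> of all \<open>\<bar>c j\<bar>\<close>, the terms after the leading one are at most
  \<open>C * T ^ (m - Suc k)\<close> in total, while the leading one is at least \<open>T * T ^ (m - Suc k)\<close>.\<close>

lemma leading_power_dominates:
  fixes c :: "nat \<Rightarrow> int"
  assumes k: "k < m" and zero: "\<And>j. j < k \<Longrightarrow> c j = 0" and pos: "0 < c k"
  shows "\<forall>\<^sub>F T in at_top. N < (\<Sum>j<m. c j * T ^ (m - j))"
proof -
  define C where "C = (\<Sum>j<m. \<bar>c j\<bar>)"
  have "N < (\<Sum>j<m. c j * T ^ (m - j))" if T: "T \<ge> 1 + C + \<bar>N\<bar>" for T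
  proof -
    have C0: "0 \<le> C" by (simp add: C_def sum_nonneg)
    have T1: "1 \<le> T" using T C0 by linarith
    let ?P = "T ^ (m - Suc k)"
    have P1: "1 \<le> ?P" using T1 by (rule one_le_power)
    have lead: "T ^ (m - k) = T * ?P" using k by (metis Suc_diff_Suc power_Suc)
    have split: "{..<m} = {..<k} \<union> (insert k {k<..<m})" using k by auto
    have "(\<Sum>j<m. c j * T ^ (m - j)) = c k * T ^ (m - k) + (\<Sum>j\<in>{k<..<m}. c j * T ^ (m - j))"
      unfolding split using zero by (subst sum.union_disjoint) auto
    moreover have "(\<Sum>j\<in>{k<..<m}. c j * T ^ (m - j)) \<ge> - (C * ?P)"
    proof -
      have "\<bar>\<Sum>j\<in>{k<..<m}. c j * T ^ (m - j)\<bar> \<le> (\<Sum>j\<in>{k<..<m}. \<bar>c j\<bar> * ?P)"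
      proof (rule order_trans[OF sum_abs sum_mono])
        fix j assume "j \<in> {k<..<m}"
        then have "T ^ (m - j) \<le> ?P" using T1 by (intro power_increasing) auto
        moreover have "0 \<le> T ^ (m - j)" using T1 by simp
        ultimately show "\<bar>c j * T ^ (m - j)\<bar> \<le> \<bar>c j\<bar> * ?P"
          by (simp add: abs_mult mult_left_mono)
      qed
      also have "\<dots> = (\<Sum>j\<in>{k<..<m}. \<bar>c j\<bar>) * ?P" by (simp add: sum_distrib_right)
      also have "\<dots> \<le> C * ?P"
        unfolding C_def using P1 by (intro mult_right_mono sum_mono2) auto
      finally show ?thesis by linarith
    qed
    moreover have "c k * T ^ (m - k) \<ge> T * ?P"
    proof -
      have "1 * (T * ?P) \<le> c k * (T * ?P)" using pos T1 P1 by (intro mult_right_mono) auto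
      then show ?thesis unfolding lead by simp
    qed
    ultimately have tail: "T * ?P - C * ?P \<le> (\<Sum>j<m. c j * T ^ (m - j))" by linarith
    have "N < T - C" using T by linarith
    also have "\<dots> = (T - C) * 1" by simp
    also have "\<dots> \<le> (T - C) * ?P"
      using T P1 by (intro mult_left_mono) auto
    also have "\<dots> = T * ?P - C * ?P" by (rule left_diff_distrib)
    also note tail
    finally show ?thesis .
  qed
  then show ?thesis unfolding eventually_at_top_linorder by blast
qed

lemma functional_eventually_large:
  assumes add: "additive_functional m \<theta>" and k: "k < m"
    and zero: "\<And>j. j < k \<Longrightarrow> \<theta> (unit_vec m j) = 0"
    and pos: "0 < \<omega> k * \<theta> (unit_vec m k)"
  shows "\<forall>\<^sub>F T in at_top. N < \<theta> (vec m (\<lambda>j. \<omega> j * T ^ (m - j)))"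
proof -
  have "\<theta> (vec m (\<lambda>j. \<omega> j * T ^ (m - j))) = (\<Sum>j<m. (\<omega> j * \<theta> (unit_vec m j)) * T ^ (m - j))" for T
    using additive_functional_expand[OF add, of "vec m (\<lambda>j. \<omega> j * T ^ (m - j))"]
    by (simp add: mult.commute mult.left_commute)
  then show ?thesis
    using leading_power_dominates[OF k, of "\<lambda>j. \<omega> j * \<theta> (unit_vec m j)" N] zero pos by simp
qed

text \<open>A nonzero functional has a first basis vector on which it does not vanish; the sign there
  decides which of \<open>\<theta>\<close> and \<open>-\<theta>\<close> becomes large.\<close>

lemma functional_eventually_avoids:
  assumes add: "additive_functional m \<theta>" and v: "v \<in> carrier_vec m" "\<theta> v \<noteq> 0"
    and \<omega>: "\<And>j. j < m \<Longrightarrow> \<omega> j \<noteq> 0"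
  shows "\<forall>\<^sub>F T in at_top. N < \<bar>\<theta> (vec m (\<lambda>j. \<omega> j * T ^ (m - j)))\<bar>"
proof -
  have "\<exists>j<m. \<theta> (unit_vec m j) \<noteq> 0"
    using additive_functional_expand[OF add v(1)] v(2) by (auto intro: ccontr)
  then obtain k where k: "k < m" "\<theta> (unit_vec m k) \<noteq> 0"
    and least: "\<And>j. j < k \<Longrightarrow> \<not> (j < m \<and> \<theta> (unit_vec m j) \<noteq> 0)"
    using exists_least_iff[of "\<lambda>j. j < m \<and> \<theta> (unit_vec m j) \<noteq> 0"] by blast
  have zero: "\<theta> (unit_vec m j) = 0" if "j < k" for j using least[OF that] that k(1) by auto
  have "\<omega> k * \<theta> (unit_vec m k) \<noteq> 0" using \<omega>[OF k(1)] k(2) by simp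
  then consider "0 < \<omega> k * \<theta> (unit_vec m k)" | "0 < \<omega> k * - \<theta> (unit_vec m k)"
    by fastforce
  then show ?thesis
  proof cases
    case 1
    show ?thesis
      by (rule eventually_mono[OF functional_eventually_large[where \<omega>=\<omega>, OF add k(1) zero 1, of N]]) auto
  next
    case 2
    have neg: "additive_functional m (\<lambda>v. - \<theta> v)"
      using add by (simp add: additive_functional_def)
    show ?thesis
      by (rule eventually_mono[OF functional_eventually_large[where \<omega>=\<omega>, OF neg k(1) _ 2, of N]])
        (use zero in auto)
  qed
qed

section \<open>Block triangular maps with signed swaps on the diagonal\<close>

text \<open>Block number \<open>k\<close> on the diagonal is \<open>\<epsilon> k\<close> times the swap. The assumptions on the rows say what
  the matrix looks like up to the diagonal blocks; the entries to their right are arbitrary.\<close>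

locale swap_triangular =
  fixes d :: nat and \<sigma> :: "int vec \<Rightarrow> int vec" and \<epsilon> :: "nat \<Rightarrow> int"
  assumes d_pos: "0 < d"
    and closed: "v \<in> carrier_vec (2 * d) \<Longrightarrow> \<sigma> v \<in> carrier_vec (2 * d)"
    and add: "v \<in> carrier_vec (2 * d) \<Longrightarrow> w \<in> carrier_vec (2 * d) \<Longrightarrow> \<sigma> (v + w) = \<sigma> v + \<sigma> w"
    and sign: "k < d \<Longrightarrow> \<epsilon> k = 1 \<or> \<epsilon> k = -1"
    and even_row: "k < d \<Longrightarrow> j \<le> 2 * k \<Longrightarrow> \<sigma> (unit_vec (2 * d) j) $ (2 * k) = 0"
    and even_row_lead: "k < d \<Longrightarrow> \<sigma> (unit_vec (2 * d) (2 * k + 1)) $ (2 * k) = \<epsilon> k"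
    and odd_row: "k < d \<Longrightarrow> j < 2 * k \<Longrightarrow> \<sigma> (unit_vec (2 * d) j) $ (2 * k + 1) = 0"
    and odd_row_lead: "k < d \<Longrightarrow> \<sigma> (unit_vec (2 * d) (2 * k)) $ (2 * k + 1) = \<epsilon> k"
    and odd_row_diag: "k < d \<Longrightarrow> \<sigma> (unit_vec (2 * d) (2 * k + 1)) $ (2 * k + 1) = 0"
begin

abbreviation L :: "int vec set" where "L \<equiv> carrier_vec (2 * d)"

text \<open>On the diagonal block \<open>k\<close>, the map \<open>-\<sigma>\<close> sends \<open>(p, q)\<close> to \<open>(- \<epsilon> k * q, - \<epsilon> k * p)\<close>. The signs
  \<open>(+, - \<epsilon> k)\<close> are preserved by this.\<close>

definition quadrant :: "int vec set" where
  "quadrant = {v \<in> L. \<forall>k<d. 0 < v $ (2 * k) \<and> 0 < - \<epsilon> k * v $ (2 * k + 1)}"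

definition orient :: "nat \<Rightarrow> int" where
  "orient j = (if even j then 1 else - \<epsilon> (j div 2))"

text \<open>Coordinate \<open>i\<close> of \<open>\<sigma> v\<close> involves only the block of \<open>i\<close> and later ones. Since earlier
  coordinates of the probe dominate later ones, the diagonal block decides its sign. The last exponent
  is \<open>1\<close>, so that every coordinate grows with \<open>T\<close>.\<close>

definition probe :: "int \<Rightarrow> int vec" where
  "probe T = vec (2 * d) (\<lambda>j. orient j * T ^ (2 * d - j))"

abbreviation s :: "int vec \<Rightarrow> int vec \<Rightarrow> int vec" where "s x y \<equiv> x + \<sigma> y"

abbreviation \<phi> :: "int vec \<Rightarrow> int" where "\<phi> v \<equiv> v $ (2 * (d - 1))"

lemma orient_even: "orient (2 * k) = 1" by (simp add: orient_def)
lemma orient_odd: "orient (Suc (2 * k)) = - \<epsilon> k" by (simp add: orient_def)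

lemma orient_nonzero:
  assumes "j < 2 * d" shows "orient j \<noteq> 0"
proof -
  have "j div 2 < d" using assms by linarith
  then show ?thesis using sign[of "j div 2"] by (auto simp: orient_def)
qed

lemma probe_closed [simp]: "probe T \<in> L" by (simp add: probe_def)

lemma coordinate_additive: "i < 2 * d \<Longrightarrow> additive_functional (2 * d) (\<lambda>v. v $ i)"
  by (auto simp: additive_functional_def)

lemma image_coordinate_additive: "i < 2 * d \<Longrightarrow> additive_functional (2 * d) (\<lambda>v. \<sigma> v $ i)"
  by (auto simp: additive_functional_def add dest: closed)

lemma \<sigma>_minus:
  assumes "v \<in> L" "w \<in> L" shows "\<sigma> (v - w) = \<sigma> v - \<sigma> w"
proof -
  have "v - w + w = v" using assms by auto
  then have "\<sigma> v = \<sigma> (v - w) + \<sigma> w" using assms add[of "v - w" w] by simp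
  then show ?thesis using assms closed[of "v - w"] closed[of w] by auto
qed

lemma index_lt: "k < d \<Longrightarrow> 2 * k < 2 * d" "k < d \<Longrightarrow> Suc (2 * k) < 2 * d" by auto

text \<open>No block stands to the right of the last diagonal block, so the last two coordinates of \<open>\<sigma> v\<close>
  depend on those of \<open>v\<close> only. This makes \<open>\<phi>\<close> invariant under \<open>\<sigma>\<^sup>2\<close>, even if \<open>\<sigma>\<close> is not an
  involution.\<close>

lemma last_pair_swapped:
  assumes v: "v \<in> L"
  shows "\<sigma> v $ (2 * (d - 1)) = \<epsilon> (d - 1) * v $ (2 * (d - 1) + 1)"
    and "\<sigma> v $ (2 * (d - 1) + 1) = \<epsilon> (d - 1) * v $ (2 * (d - 1))"
proof -
  let ?n = "2 * (d - 1)"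
  have n: "?n < 2 * d" "?n + 1 < 2 * d" using d_pos by auto
  have idx: "{..<2 * d} = insert ?n (insert (?n + 1) {..<?n})" using d_pos by auto
  have k: "d - 1 < d" using d_pos by simp
  have "\<sigma> v $ ?n = (\<Sum>j<2*d. v $ j * \<sigma> (unit_vec (2*d) j) $ ?n)"
    using additive_functional_expand[OF image_coordinate_additive[OF n(1)] v] .
  also have "\<dots> = \<epsilon> (d - 1) * v $ (?n + 1)"
    unfolding idx using even_row[OF k] even_row_lead[OF k] by simp
  finally show "\<sigma> v $ ?n = \<epsilon> (d - 1) * v $ (?n + 1)" .
  have "\<sigma> v $ (?n + 1) = (\<Sum>j<2*d. v $ j * \<sigma> (unit_vec (2*d) j) $ (?n + 1))"
    using additive_functional_expand[OF image_coordinate_additive[OF n(2)] v] .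
  also have "\<dots> = \<epsilon> (d - 1) * v $ ?n"
    unfolding idx using odd_row[OF k] odd_row_lead[OF k] odd_row_diag[OF k] by simp
  finally show "\<sigma> v $ (?n + 1) = \<epsilon> (d - 1) * v $ ?n" .
qed

lemma \<phi>_\<sigma>_twice:
  assumes v: "v \<in> L" shows "\<phi> (\<sigma> (\<sigma> v)) = \<phi> v"
  using last_pair_swapped[OF v] last_pair_swapped[OF closed[OF v]] sign[of "d - 1"] d_pos by auto

lemma probe_eventually_quadrant: "\<forall>\<^sub>F T in at_top. probe T \<in> quadrant"
proof -
  have "\<forall>\<^sub>F T in at_top. 0 < probe T $ (2 * k) \<and> 0 < - \<epsilon> k * probe T $ (2 * k + 1)" if k: "k < d" for k
  proof (rule eventually_mono[OF eventually_gt_at_top[of 0]])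
    fix T :: int assume "0 < T"
    then show "0 < probe T $ (2 * k) \<and> 0 < - \<epsilon> k * probe T $ (2 * k + 1)"
      using index_lt[OF k] sign[OF k] k by (auto simp: probe_def orient_even orient_odd)
  qed
  then have "\<forall>\<^sub>F T in at_top. \<forall>k\<in>{..<d}. 0 < probe T $ (2 * k) \<and> 0 < - \<epsilon> k * probe T $ (2 * k + 1)"
    by (intro eventually_ball_finite) auto
  then show ?thesis by (rule eventually_mono) (simp add: quadrant_def)
qed

text \<open>In coordinate \<open>2 * k\<close> of \<open>\<sigma> (probe T)\<close> the leading term comes from the basis vector number
  \<open>2 * k + 1\<close>, and vice versa. It has the sign required by the quadrant and eventually outweighs
  the coordinate of \<open>g\<close>.\<close>

lemma complement_eventually_quadrant:
  assumes g: "g \<in> L"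
  shows "\<forall>\<^sub>F T in at_top. g - \<sigma> (probe T) \<in> quadrant"
proof -
  have "\<forall>\<^sub>F T in at_top. 0 < (g - \<sigma> (probe T)) $ (2 * k) \<and> 0 < - \<epsilon> k * (g - \<sigma> (probe T)) $ (2 * k + 1)"
    if k: "k < d" for k
  proof -
    note i = index_lt[OF k]
    have dim: "dim_vec (\<sigma> (probe T)) = 2 * d" for T using closed[of "probe T"] by auto
    have add0: "additive_functional (2 * d) (\<lambda>v. - \<sigma> v $ (2 * k))"
      and add1: "additive_functional (2 * d) (\<lambda>v. \<epsilon> k * \<sigma> v $ Suc (2 * k))"
      using image_coordinate_additive[OF i(1)] image_coordinate_additive[OF i(2)]
      by (auto simp: additive_functional_def algebra_simps)
    have "\<forall>\<^sub>F T in at_top. - g $ (2 * k) < - \<sigma> (probe T) $ (2 * k)"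
      unfolding probe_def
      by (rule functional_eventually_large[OF add0 i(2)])
        (use k even_row[OF k] even_row_lead[OF k] sign[OF k] in \<open>auto simp: orient_odd\<close>)
    moreover have "\<forall>\<^sub>F T in at_top. \<epsilon> k * g $ Suc (2 * k) < \<epsilon> k * \<sigma> (probe T) $ Suc (2 * k)"
      unfolding probe_def
      by (rule functional_eventually_large[OF add1 i(1)])
        (use k odd_row[OF k] odd_row_lead[OF k] sign[OF k] in \<open>auto simp: orient_even\<close>)
    ultimately show ?thesis
    proof eventually_elim
      case (elim T)
      then show ?case using i g dim[of T] by (auto simp: algebra_simps)
    qed
  qed
  then have "\<forall>\<^sub>F T in at_top. \<forall>k\<in>{..<d}.
      0 < (g - \<sigma> (probe T)) $ (2 * k) \<and> 0 < - \<epsilon> k * (g - \<sigma> (probe T)) $ (2 * k + 1)"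
    by (intro eventually_ball_finite) auto
  then show ?thesis
    by (rule eventually_mono) (use g closed in \<open>auto simp: quadrant_def\<close>)
qed

text \<open>The reversed sum equals \<open>\<sigma> g + (b - \<sigma> (\<sigma> b))\<close> for \<open>b = probe T\<close>. In the case of an involution
  this is \<open>\<sigma> g\<close> for every \<open>T\<close>, and \<open>\<sigma> g = x + \<sigma> y\<close> would give \<open>g = y + \<sigma> x\<close>. Otherwise some
  coordinate of \<open>v - \<sigma> (\<sigma> v)\<close> is a nonzero functional \<open>\<theta>\<close>, which is unbounded along the
  probes.\<close>

lemma reversed_sum_eventually_new:
  assumes A: "A \<subseteq> L" "finite A" and g: "g \<in> L" "g \<notin> pair_values s A"
  shows "\<forall>\<^sub>F T in at_top. probe T + \<sigma> (g - \<sigma> (probe T)) \<notin> pair_values s A"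
proof -
  have expand: "\<sigma> (g - \<sigma> v) = \<sigma> g - \<sigma> (\<sigma> v)" if "v \<in> L" for v
    using that g(1) closed by (simp add: \<sigma>_minus)
  show ?thesis
  proof (cases "\<forall>v\<in>L. \<sigma> (\<sigma> v) = v")
    case True
    have "probe T + \<sigma> (g - \<sigma> (probe T)) \<notin> pair_values s A" for T
    proof
      assume "probe T + \<sigma> (g - \<sigma> (probe T)) \<in> pair_values s A"
      then obtain x y where xy: "x \<in> A" "y \<in> A" "probe T + \<sigma> (g - \<sigma> (probe T)) = x + \<sigma> y"
        by (rule pair_valuesE)
      have "probe T + (\<sigma> g - probe T) = \<sigma> g"
        using closed[OF g(1)] probe_closed[of T] by (intro eq_vecI) (auto simp del: probe_closed)
      then have \<sigma>g: "\<sigma> g = x + \<sigma> y"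
        using xy(3) expand[of "probe T"] True by simp
      have xL: "x \<in> L" and yL: "y \<in> L" using xy(1,2) A(1) by auto
      have "g = \<sigma> (\<sigma> g)" using True g(1) by simp
      also have "\<dots> = \<sigma> x + \<sigma> (\<sigma> y)" unfolding \<sigma>g by (rule add[OF xL closed[OF yL]])
      also have "\<dots> = \<sigma> x + y" using True yL by simp
      also have "\<dots> = y + \<sigma> x" by (rule comm_add_vec[OF closed[OF xL] yL])
      finally have "g \<in> pair_values s A" using pair_valuesI[OF xy(2,1), of s] by simp
      then show False using g by simp
    qed
    then show ?thesis by simp
  next
    case False
    then obtain v where v: "v \<in> L" "\<sigma> (\<sigma> v) \<noteq> v" by blast
    then have "\<exists>i<2 * d. \<sigma> (\<sigma> v) $ i \<noteq> v $ i"
      using closed[OF closed[OF v(1)]] by (metis eq_vecI carrier_vecD)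
    then obtain i where i: "i < 2 * d" "\<sigma> (\<sigma> v) $ i \<noteq> v $ i" by blast
    define \<theta> where "\<theta> = (\<lambda>v. v $ i - \<sigma> (\<sigma> v) $ i)"
    have add: "additive_functional (2 * d) \<theta>"
      unfolding additive_functional_def \<theta>_def
      using i(1) by (auto simp: add closed dest: closed[OF closed])
    define N where "N = (\<Sum>h\<in>pair_values s A. \<bar>h $ i - \<sigma> g $ i\<bar>)"
    have "pair_values s A = (\<lambda>(x, y). s x y) ` (A \<times> A)" by (auto simp: pair_values_def)
    then have fin: "finite (pair_values s A)" using A(2) by simp
    have "\<forall>\<^sub>F T in at_top. N < \<bar>\<theta> (probe T)\<bar>"
      unfolding probe_def
      by (rule functional_eventually_avoids[OF add v(1)])
        (use i orient_nonzero in \<open>auto simp: \<theta>_def\<close>)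
    then show ?thesis
    proof (rule eventually_mono)
      fix T assume T: "N < \<bar>\<theta> (probe T)\<bar>"
      show "probe T + \<sigma> (g - \<sigma> (probe T)) \<notin> pair_values s A"
      proof
        let ?h = "probe T + \<sigma> (g - \<sigma> (probe T))"
        assume h: "?h \<in> pair_values s A"
        have "?h $ i = \<theta> (probe T) + \<sigma> g $ i"
          using expand[of "probe T"] i(1) closed[OF closed[OF probe_closed[of T]]] closed[OF g(1)]
          by (auto simp: \<theta>_def)
        then have "\<bar>\<theta> (probe T)\<bar> = \<bar>?h $ i - \<sigma> g $ i\<bar>" by simp
        also have "\<dots> \<le> N" unfolding N_def by (rule member_le_sum[OF h]) (use fin in auto)
        finally show False using T by simp
      qed
    qed
  qed
qed

text \<open>All requirements on the new point \<open>b = probe T\<close> hold for large \<open>T\<close>, hence for a common one.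
  Additivity and \<open>\<phi> (\<sigma> (\<sigma> b)) = \<phi> b\<close> yield the two crossed bounds, with \<open>\<phi> a + \<phi> (\<sigma> b) = \<phi> g\<close> and
  \<open>\<phi> b + \<phi> (\<sigma> a) = \<phi> (\<sigma> g)\<close>.\<close>

lemma extend_to_represent:
  assumes A: "A \<subseteq> quadrant" "finite A" "A \<noteq> {}" "irredundant s A" and g: "g \<in> L"
  shows "\<exists>A'. A' \<subseteq> quadrant \<and> finite A' \<and> irredundant s A' \<and> pure_extension s A A' \<and>
    g \<in> pair_values s A'"
proof (cases "g \<in> pair_values s A")
  case True
  then show ?thesis using A pure_extension_refl by blast
next
  case False
  have AL: "A \<subseteq> L" using A(1) by (auto simp: quadrant_def)
  let ?n = "2 * (d - 1)"
  have n: "?n < 2 * d" "Suc ?n < 2 * d" and k: "d - 1 < d" using d_pos by auto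
  define M where "M = (\<Sum>x\<in>insert g A. \<bar>\<phi> x\<bar> + \<bar>\<phi> (\<sigma> x)\<bar>)"
  have M: "\<bar>\<phi> x\<bar> + \<bar>\<phi> (\<sigma> x)\<bar> \<le> M" if "x \<in> insert g A" for x
    unfolding M_def by (rule member_le_sum[OF that]) (use A(2) in auto)
  have add: "additive_functional (2 * d) (\<lambda>v. - \<phi> (\<sigma> v))"
    "additive_functional (2 * d) (\<lambda>v. \<phi> v + 3 * \<phi> (\<sigma> v))"
    using coordinate_additive[OF n(1)] image_coordinate_additive[OF n(1)]
    by (auto simp: additive_functional_def)
  have "\<forall>\<^sub>F T in at_top. 5 * M < - \<phi> (\<sigma> (probe T))"
    unfolding probe_def
    by (rule functional_eventually_large[OF add(1) n(2)])
      (use even_row[OF k] even_row_lead[OF k] sign[OF k] orient_odd[of "d - 1"] in auto)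
  moreover have "\<forall>\<^sub>F T in at_top. 5 * M < \<phi> (probe T) + 3 * \<phi> (\<sigma> (probe T))"
    unfolding probe_def
    by (rule functional_eventually_large[OF add(2) n(1)])
      (use even_row[OF k] n orient_even[of "d - 1"] in auto)
  moreover note probe_eventually_quadrant complement_eventually_quadrant[OF g]
    reversed_sum_eventually_new[OF AL A(2) g False]
  ultimately have "\<forall>\<^sub>F T in at_top. 5 * M < - \<phi> (\<sigma> (probe T)) \<and>
     5 * M < \<phi> (probe T) + 3 * \<phi> (\<sigma> (probe T)) \<and> probe T \<in> quadrant \<and>
     g - \<sigma> (probe T) \<in> quadrant \<and> probe T + \<sigma> (g - \<sigma> (probe T)) \<notin> pair_values s A"
    by eventually_elim blast
  then obtain T where T: "5 * M < - \<phi> (\<sigma> (probe T))"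
    "5 * M < \<phi> (probe T) + 3 * \<phi> (\<sigma> (probe T))" "probe T \<in> quadrant"
    "g - \<sigma> (probe T) \<in> quadrant" "probe T + \<sigma> (g - \<sigma> (probe T)) \<notin> pair_values s A"
    using eventually_happens'[OF trivial_limit_at_top_linorder] by blast
  define b where "b = probe T"
  define a where "a = g - \<sigma> b"
  have bL: "b \<in> L" and aL: "a \<in> L" using g closed[of b] by (auto simp: b_def a_def)
  have \<sigma>b: "\<sigma> b \<in> L" "\<sigma> (\<sigma> b) \<in> L" "\<sigma> g \<in> L" using bL g closed by auto
  have ab: "s a b = g" using \<sigma>b g by (auto simp: a_def)
  have \<phi>a: "\<phi> a = \<phi> g - \<phi> (\<sigma> b)" using \<sigma>b n by (simp add: a_def)
  have \<psi>a: "\<phi> (\<sigma> a) = \<phi> (\<sigma> g) - \<phi> b"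
    using \<sigma>b n \<sigma>_minus[OF g \<sigma>b(1)] \<phi>_\<sigma>_twice[OF bL] by (simp add: a_def)
  have F: "\<phi> (s x y) = \<phi> x + \<phi> (\<sigma> y)" if "x \<in> insert a (insert b A)" "y \<in> insert a (insert b A)" for x y
  proof -
    have "y \<in> L" using that aL bL AL by auto
    then show ?thesis using closed[of y] n by simp
  qed
  have Mg: "\<bar>\<phi> g\<bar> \<le> M" "\<bar>\<phi> (\<sigma> g)\<bar> \<le> M" using M[of g] by auto
  have adj: "pure_extension s A (insert a (insert b A))" "irredundant s (insert a (insert b A))"
  proof -
    have bound: "\<bar>\<phi> x\<bar> \<le> M \<and> \<bar>\<phi> (\<sigma> x)\<bar> \<le> M" if "x \<in> A" for x using M[of x] that by auto
    have cross: "\<bar>\<phi> a + \<phi> (\<sigma> b)\<bar> \<le> M" "\<bar>\<phi> b + \<phi> (\<sigma> a)\<bar> \<le> M" using \<phi>a \<psi>a Mg by auto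
    have new: "s a b \<notin> pair_values s A" "s b a \<notin> pair_values s A"
      using False ab T(5) by (auto simp: a_def b_def)
    have big: "5 * M < - \<phi> (\<sigma> b)" "5 * M < \<phi> b + 3 * \<phi> (\<sigma> b)"
      using T(1,2) unfolding b_def by simp_all
    show "pure_extension s A (insert a (insert b A))" "irredundant s (insert a (insert b A))"
      using irredundant_adjoin_pair[where F = \<phi> and \<phi> = \<phi> and \<psi> = "\<lambda>v. \<phi> (\<sigma> v)",
          OF F A(3,4) bound cross new big] by blast+
  qed
  moreover have "insert a (insert b A) \<subseteq> quadrant" using A(1) T(3,4) by (auto simp: a_def b_def)
  moreover have "g \<in> pair_values s (insert a (insert b A))"
    using pair_valuesI[of a "insert a (insert b A)" b s] ab by simp
  ultimately show ?thesis
    using A(2) by (intro exI[of _ "insert a (insert b A)"]) simp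
qed

text \<open>The construction starts from any single point: its only sum has one representation.\<close>

lemma irredundant_cover:
  "\<exists>A. A \<subseteq> quadrant \<and> A \<noteq> {} \<and> irredundant s A \<and> L \<subseteq> pair_values s A"
proof -
  obtain T where T: "probe T \<in> quadrant"
    using eventually_happens'[OF trivial_limit_at_top_linorder probe_eventually_quadrant] by blast
  have "countable (range (vec_of_list :: int list \<Rightarrow> int vec))" by (intro countable_image countableI_type)
  moreover have "L \<subseteq> range vec_of_list" by (metis rangeI subsetI vec_list)
  ultimately have "countable L" by (rule countable_subset[rotated])
  then show ?thesis
  proof (rule irredundant_cover_by_exhaustion)
    show "{probe T} \<subseteq> quadrant" "finite {probe T}" "{probe T} \<noteq> {}" using T by auto
    show "irredundant s {probe T}" by (simp add: irredundant_def)
  qed (rule extend_to_represent)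
qed

lemma quadrant_contained:
  assumes "A \<subseteq> quadrant" shows "contained_in_quadrant (2 * d) A"
  unfolding contained_in_quadrant_def
proof (intro conjI allI impI)
  show "A \<subseteq> L" using assms by (auto simp: quadrant_def)
  fix i assume i: "i < 2 * d"
  define k where "k = i div 2"
  have k: "k < d" using i by (auto simp: k_def)
  have q: "0 < x $ (2 * k) \<and> 0 < - \<epsilon> k * x $ (2 * k + 1)" if "x \<in> A" for x
    using assms that k by (auto simp: quadrant_def)
  have "i = 2 * k \<or> i = 2 * k + 1" by (auto simp: k_def)
  then show "(\<forall>x\<in>A. 0 < x $ i) \<or> (\<forall>x\<in>A. x $ i < 0)"
    using q sign[OF k] by fastforce
qed

end

section \<open>Existence of the co-minimal pair\<close>

theorem theorem4p4:
  fixes d :: nat and \<sigma> :: "int vec \<Rightarrow> int vec"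
  assumes "d \<ge> 1"
    and "\<sigma> \<in> iso (int_lattice (2 * d)) (int_lattice (2 * d))"
    and "block2_upper_triangular d (matrix_of_map (2 * d) \<sigma>)"
    and "\<forall>k<d. block2 (matrix_of_map (2 * d) \<sigma>) k k \<in>
           {mat_of_rows_list 2 [[0, 1], [1, 0]], mat_of_rows_list 2 [[0, -1], [-1, 0]]}"
  shows "\<exists>A. contained_in_quadrant (2 * d) A \<and>
             co_minimal_pair (int_lattice (2 * d)) A (\<sigma> ` A)"
proof -
  let ?M = "matrix_of_map (2 * d) \<sigma>"
  have hom: "\<sigma> \<in> hom (int_lattice (2 * d)) (int_lattice (2 * d))"
    using assms(2) by (simp add: iso_def)
  have entry: "\<sigma> (unit_vec (2 * d) j) $ i = ?M $$ (i, j)" if "i < 2 * d" "j < 2 * d" for i j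
    using that by (simp add: matrix_of_map_def)
  have block: "?M $$ (2 * k + p, 2 * l + q) = block2 ?M k l $$ (p, q)"
    if "p < 2" "q < 2" for k l p q using that by (simp add: block2_def)
  define \<epsilon> where "\<epsilon> k = ?M $$ (2 * k, 2 * k + 1)" for k
  have diag: "?M $$ (2 * k, 2 * k) = 0" "?M $$ (2 * k + 1, 2 * k + 1) = 0"
    "?M $$ (2 * k + 1, 2 * k) = \<epsilon> k" "\<epsilon> k = 1 \<or> \<epsilon> k = -1" if k: "k < d" for k
  proof -
    have "block2 ?M k k \<in> {mat_of_rows_list 2 [[0, 1], [1, 0]], mat_of_rows_list 2 [[0, -1], [-1, 0]]}"
      using assms(4) k by blast
    then show "?M $$ (2 * k, 2 * k) = 0" "?M $$ (2 * k + 1, 2 * k + 1) = 0"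
      "?M $$ (2 * k + 1, 2 * k) = \<epsilon> k" "\<epsilon> k = 1 \<or> \<epsilon> k = -1"
      using block[of 0 0 k k] block[of 1 1 k k] block[of 1 0 k k] block[of 0 1 k k]
      by (auto simp: \<epsilon>_def mat_of_rows_list_def)
  qed
  have below: "?M $$ (2 * k + p, j) = 0" if "k < d" "j < 2 * k" "p < 2" for k j p
  proof -
    have "j div 2 < k" using that(2) by auto
    then have "block2 ?M k (j div 2) = 0\<^sub>m 2 2"
      using assms(3) that(1) by (auto simp: block2_upper_triangular_def)
    then show ?thesis using block[of p "j mod 2" k "j div 2"] that(3) by simp
  qed
  interpret swap_triangular d \<sigma> \<epsilon>
  proof
    show "0 < d" using assms(1) by simp
    show "\<sigma> v \<in> carrier_vec (2 * d)" if "v \<in> carrier_vec (2 * d)" for v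
      using hom that by (auto simp: hom_def monoid_vec_def)
    show "\<sigma> (v + w) = \<sigma> v + \<sigma> w" if "v \<in> carrier_vec (2 * d)" "w \<in> carrier_vec (2 * d)" for v w
      using hom that by (auto simp: hom_def monoid_vec_def)
    fix k assume k: "k < d"
    show "\<epsilon> k = 1 \<or> \<epsilon> k = -1" using diag k by blast
    show "\<sigma> (unit_vec (2 * d) j) $ (2 * k) = 0" if "j \<le> 2 * k" for j
      using below[OF k, of j 0] diag(1)[OF k] that k by (cases "j = 2 * k") (auto simp: entry)
    show "\<sigma> (unit_vec (2 * d) (2 * k + 1)) $ (2 * k) = \<epsilon> k"
      using k by (simp add: entry \<epsilon>_def)
    show "\<sigma> (unit_vec (2 * d) j) $ (2 * k + 1) = 0" if "j < 2 * k" for j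
      using below[OF k that, of 1] that k by (simp add: entry)
    show "\<sigma> (unit_vec (2 * d) (2 * k)) $ (2 * k + 1) = \<epsilon> k"
      using diag(3)[OF k] k by (simp add: entry)
    show "\<sigma> (unit_vec (2 * d) (2 * k + 1)) $ (2 * k + 1) = 0"
      using diag(2)[OF k] k by (simp add: entry)
  qed
  obtain A where A: "A \<subseteq> quadrant" "A \<noteq> {}" "irredundant s A" "L \<subseteq> pair_values s A"
    using irredundant_cover by blast
  have carr: "carrier (int_lattice (2 * d)) = L" and mult: "mult (int_lattice (2 * d)) = (+)"
    by (simp_all add: monoid_vec_def)
  have "co_minimal_pair (int_lattice (2 * d)) A (\<sigma> ` A)"
  proof (rule co_minimal_pair_if_irredundant_cover)
    show "A \<subseteq> carrier (int_lattice (2 * d))" using A(1) by (auto simp: carr quadrant_def)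
    show "\<sigma> \<in> carrier (int_lattice (2 * d)) \<rightarrow> carrier (int_lattice (2 * d))"
      using closed by (auto simp: carr)
    show "monoid (int_lattice (2 * d))"
      using comm_group_vec by (auto simp: comm_group_def group_def)
  qed (use A in \<open>simp_all add: carr mult\<close>)
  with quadrant_contained[OF A(1)] show ?thesis by blast
qed

end
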